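(* Let $R=\mathbb{Z}[t]/(t^3)$ and let $p$ be a prime. Then, writing $X=p^{-s_1}$ and $Y=p^{-s_2}$, \[ \zeta_{R,p}(s_1,s_2)=\frac{1+X+pX^2-pX^3Y-p^2X^4Y-p^2X^5Y}{(1-XY)(1-pX^2Y)(1-p^2X^3)} . \] This holds as an identity of formal power series in $X,Y$, and hence as an identity of functions for all complex $s_1,s_2$ with real parts sufficiently large.
   Context: Let $R=\mathbb{Z}[t]/(t^3)$, viewed as the additive group $\mathbb{Z}^3$ with basis $t^2,t,1$. A subring $S$ of $R$ means an additive subgroup of finite index that contains $1$ and is closed under multiplication. For a finite-index subgroup $S\subseteq R$ there are unique positive integers $\alpha_1(S),\alpha_2(S),\alpha_3(S)$ with $\alpha_{i+1}\mid\alpha_i$ and $R/S\cong \mathbb{Z}/\alpha_1\mathbb{Z}\oplus\mathbb{Z}/\alpha_2\mathbb{Z}\oplus\mathbb{Z}/\alpha_3\mathbb{Z}$. The tuple $(\alpha_1(S),\alpha_2(S),\alpha_3(S))$ is called the cotype of $S$. For a subring $S$ one always has $\alpha_3(S)=1$. For a prime $p$ define \[ \zeta_{R,p}(s_1,s_2)=\sum_{S}\alpha_1(S)^{-s_1}\alpha_2(S)^{-s_2}, \] where the sum runs over all subrings $S$ of $R$ whose index $[R:S]$ is a power of $p$ (including index $1$). For such $S$ one has $\alpha_1(S)=p^a$ and $\alpha_2(S)=p^b$ for some $a,b\ge 0$, so $\zeta_{R,p}(s_1,s_2)$ is a power series in $X=p^{-s_1}$ and $Y=p^{-s_2}$. 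*)

theory Defs
  imports "HOL-Algebra.Elementary_Groups" "HOL-Computational_Algebra.Formal_Power_Series"
begin

text \<open>R = Z[t]/(t^3), viewed additively as Z^3 with basis t^2, t, 1:
  the triple (a, b, c) stands for a*t^2 + b*t + c.\<close>

definition R_group :: "(int \<times> int \<times> int) monoid" where
  "R_group = integer_group \<times>\<times> integer_group \<times>\<times> integer_group"

fun R_mult :: "int \<times> int \<times> int \<Rightarrow> int \<times> int \<times> int \<Rightarrow> int \<times> int \<times> int" where
  "R_mult (a, b, c) (a', b', c') = (a * c' + c * a' + b * b', b * c' + c * b', c * c')"

definition R_one :: "int \<times> int \<times> int" where
  "R_one = (0, 0, 1)"

definition R_index :: "(int \<times> int \<times> int) set \<Rightarrow> nat" where
  "R_index S = card (carrier (R_group Mod S))"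

definition is_subring :: "(int \<times> int \<times> int) set \<Rightarrow> bool" where
  "is_subring S \<longleftrightarrow> subgroup S R_group \<and> finite (carrier (R_group Mod S)) \<and>
     R_one \<in> S \<and> (\<forall>x\<in>S. \<forall>y\<in>S. R_mult x y \<in> S)"

definition has_cotype :: "(int \<times> int \<times> int) set \<Rightarrow> nat \<Rightarrow> nat \<Rightarrow> nat \<Rightarrow> bool" where
  "has_cotype S a1 a2 a3 \<longleftrightarrow> a1 > 0 \<and> a2 > 0 \<and> a3 > 0 \<and> a2 dvd a1 \<and> a3 dvd a2 \<and>
     (R_group Mod S) \<cong> (integer_mod_group a1 \<times>\<times> integer_mod_group a2 \<times>\<times> integer_mod_group a3)"

definition cotype :: "(int \<times> int \<times> int) set \<Rightarrow> nat \<times> nat \<times> nat" where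
  "cotype S = (THE (a1, a2, a3). has_cotype S a1 a2 a3)"

definition alpha1 :: "(int \<times> int \<times> int) set \<Rightarrow> nat" where
  "alpha1 S = fst (cotype S)"

definition alpha2 :: "(int \<times> int \<times> int) set \<Rightarrow> nat" where
  "alpha2 S = fst (snd (cotype S))"

text \<open>Local zeta function as a bivariate formal power series:
  outer variable X (= p^-s1), inner variable Y (= p^-s2).
  The coefficient of X^a Y^b counts subrings S of p-power index with
  alpha1 S = p^a and alpha2 S = p^b.\<close>
definition zeta_R_p :: "nat \<Rightarrow> int fps fps" where
  "zeta_R_p p = Abs_fps (\<lambda>a. Abs_fps (\<lambda>b. int (card
     {S. is_subring S \<and> (\<exists>k. R_index S = p ^ k) \<and> alpha1 S = p ^ a \<and> alpha2 S = p ^ b})))"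

definition fpsX :: "int fps fps" where "fpsX = fps_X"
definition fpsY :: "int fps fps" where "fpsY = fps_const fps_X"

end

theory Submission
  imports Defs "HOL-Algebra.Multiplicative_Group"
begin

unbundle fps_syntax

text \<open>
  A subring \<open>S\<close> contains 1, so it is determined by the lattice \<open>T\<close> of pairs \<open>(x, y)\<close> with
  \<open>x t\<^sup>2 + y t \<in> S\<close>. If \<open>S\<close> has \<open>p\<close>-power index, \<open>T\<close> is \<open>p\<^sup>b\<close> times a lattice with cyclic quotient of
  order \<open>p\<^sup>n\<close>, and the cotype of \<open>S\<close> is \<open>(p\<^sup>a, p\<^sup>b, 1)\<close> with \<open>a = n + b\<close>. The lattices with cyclic
  quotient are the points of the projective line over \<open>Z/p\<^sup>n\<close>: either \<open>p\<^sup>n\<close> divides \<open>y + u x\<close>, with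
  any residue \<open>u\<close>, or \<open>p\<^sup>n\<close> divides \<open>x + v y\<close>, with \<open>p\<close> dividing \<open>v\<close> and \<open>n \<ge> 1\<close>. Closure under
  multiplication amounts to \<open>p\<^sup>n\<close> dividing \<open>u\<^sup>3 p\<^sup>b\<close> in the first case and to \<open>n \<le> b\<close> in the second.
  This gives a closed form for the coefficients of the zeta function, on which the three
  factors of the denominator act one after the other as difference operators.
\<close>

subsection \<open>Uniqueness of the cotype\<close>

lemma card_multiples:
  fixes c m :: nat
  assumes "c > 0"
  shows "card {x \<in> {0..<int (c * m)}. int c dvd x} = m"
proof -
  have "{x \<in> {0..<int (c * m)}. int c dvd x} = (*) (int c) ` {0..<int m}"
  proof (intro equalityI subsetI)
    fix x assume x: "x \<in> {x \<in> {0..<int (c * m)}. int c dvd x}"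
    then obtain y where y: "x = int c * y" by auto
    have "0 \<le> y" using x assms by (auto simp: y zero_le_mult_iff)
    moreover have "y < int m" using x assms by (auto simp: y)
    ultimately show "x \<in> (*) (int c) ` {0..<int m}" by (auto simp: y)
  qed (use assms in auto)
  moreover have "inj_on ((*) (int c)) {0..<int m}"
    using assms by (auto simp: inj_on_def)
  ultimately show ?thesis by (simp add: card_image)
qed

text \<open>The sizes of these sets are isomorphism invariants, and for a finite abelian group they
  recover the invariant factors.\<close>

definition torsion :: "('a, 'b) monoid_scheme \<Rightarrow> nat \<Rightarrow> 'a set" where
  "torsion G k = {x \<in> carrier G. x [^]\<^bsub>G\<^esub> k = \<one>\<^bsub>G\<^esub>}"

lemma card_torsion_iso:
  assumes "G \<cong> H" "group G" "group H"
  shows "card (torsion G k) = card (torsion H k)"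
proof -
  obtain f where f: "f \<in> iso G H" using assms(1) by (auto simp: is_iso_def)
  then have hom: "f \<in> hom G H" and bij: "bij_betw f (carrier G) (carrier H)"
    by (auto simp: iso_def)
  interpret group_hom G H f using assms hom by (auto simp: group_hom_def group_hom_axioms_def)
  have *: "f x [^]\<^bsub>H\<^esub> k = \<one>\<^bsub>H\<^esub> \<longleftrightarrow> x [^]\<^bsub>G\<^esub> k = \<one>\<^bsub>G\<^esub>" if "x \<in> carrier G" for x
  proof -
    have "f x [^]\<^bsub>H\<^esub> k = f (x [^]\<^bsub>G\<^esub> k)"
      using hom_nat_pow[OF that] by simp
    then show ?thesis
      using bij that by (metis G.nat_pow_closed G.one_closed bij_betw_imp_inj_on inj_onD hom_one)
  qed
  have "f ` torsion G k = torsion H k"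
  proof (intro equalityI subsetI)
    fix y assume y: "y \<in> torsion H k"
    then obtain x where x: "x \<in> carrier G" "y = f x"
      using bij by (auto simp: torsion_def bij_betw_def)
    then have "x \<in> torsion G k" using y * by (simp add: torsion_def)
    then show "y \<in> f ` torsion G k" using x by blast
  qed (use * in \<open>auto simp: torsion_def\<close>)
  moreover have "inj_on f (torsion G k)"
    using bij by (auto simp: bij_betw_def torsion_def inj_on_def)
  ultimately show ?thesis by (metis card_image)
qed

lemma nat_pow_DirProd:
  "(x, y) [^]\<^bsub>G \<times>\<times> H\<^esub> (k::nat) = (x [^]\<^bsub>G\<^esub> k, y [^]\<^bsub>H\<^esub> k)"
  by (induction k) (simp_all add: nat_pow_def)

lemma torsion_DirProd: "torsion (G \<times>\<times> H) k = torsion G k \<times> torsion H k"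
  by (auto simp: torsion_def nat_pow_DirProd)

text \<open>Dividing \<open>n\<close> and \<open>k\<close> by \<open>g = gcd k n\<close> leaves
  coprime \<open>n'\<close> and \<open>k'\<close>, so \<open>k * x\<close> vanishes modulo
  \<open>n\<close> exactly when \<open>n'\<close> divides \<open>x\<close>.\<close>

lemma card_torsion_integer_mod_group:
  assumes "n > 0"
  shows "card (torsion (integer_mod_group n) k) = gcd k n"
proof -
  define g where "g = gcd k n"
  have g: "g > 0" using assms by (simp add: g_def)
  obtain n' where n': "n = n' * g" by (metis g_def dvd_def gcd_dvd2 mult.commute)
  obtain k' where k': "k = k' * g" by (metis g_def dvd_def gcd_dvd1 mult.commute)
  have "gcd (g * k') (g * n') = g" unfolding k'[unfolded mult.commute[of k'], symmetric]
      n'[unfolded mult.commute[of n'], symmetric] by (simp add: g_def)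
  then have "gcd k' n' * g = g" using gcd_mult_distrib_nat[of g k' n'] by (simp add: mult.commute)
  then have cop: "coprime (int n') (int k')" using g by (simp add: coprime_iff_gcd_eq_1 gcd.commute)
  have "int n dvd int k * x \<longleftrightarrow> int n' dvd x" for x
  proof -
    have "int n dvd int k * x \<longleftrightarrow> int g * int n' dvd int g * (int k' * x)"
      by (simp add: n' k' mult_ac)
    also have "\<dots> \<longleftrightarrow> int n' dvd x"
      using g cop by (simp add: coprime_dvd_mult_right_iff)
    finally show ?thesis .
  qed
  then have "torsion (integer_mod_group n) k = {x \<in> {0..<int (n' * g)}. int n' dvd x}"
    using assms by (auto simp: torsion_def carrier_integer_mod_group n'[symmetric] mod_eq_0_iff_dvd)
  then show ?thesis using card_multiples[of n' g] assms n' unfolding g_def[symmetric] by simp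
qed

abbreviation cotype_group :: "nat \<Rightarrow> nat \<Rightarrow> nat \<Rightarrow> (int \<times> int \<times> int) monoid" where
  "cotype_group a1 a2 a3 \<equiv> integer_mod_group a1 \<times>\<times> integer_mod_group a2 \<times>\<times> integer_mod_group a3"

lemma group_cotype_group: "group (cotype_group a1 a2 a3)"
  by (intro DirProd_group group_integer_mod_group)

text \<open>At \<open>k = a3\<close> the torsion count on the left is the cube of \<open>a3\<close>,
  while each factor on the right is at most \<open>a3\<close>, so none can be smaller. At
  \<open>k = a2\<close> the common factor \<open>a3\<close> cancels and the same argument
  applies.\<close>

lemma iso_cotype_group_dvd:
  assumes pos: "a1 > 0" "a2 > 0" "a3 > 0" "b1 > 0" "b2 > 0" "b3 > (0::nat)"
    and dvd: "a2 dvd a1" "a3 dvd a2" "b2 dvd b1" "b3 dvd b2"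
    and iso: "cotype_group a1 a2 a3 \<cong> cotype_group b1 b2 b3"
  shows "a3 dvd b3" "a3 = b3 \<Longrightarrow> a2 dvd b2"
proof -
  have tors: "gcd k a1 * (gcd k a2 * gcd k a3) = gcd k b1 * (gcd k b2 * gcd k b3)" for k
    using card_torsion_iso[OF iso group_cotype_group group_cotype_group, of k] pos
    by (simp add: torsion_DirProd card_cartesian_product card_torsion_integer_mod_group)
  have max3: "z = m" if "x * (y * z) = m * (m * m)" "x \<le> m" "y \<le> m" "z \<le> m" "m > 0" for x y z m :: nat
  proof (rule ccontr)
    assume "z \<noteq> m"
    have "(x * y) * z \<le> (m * m) * z" using that by (intro mult_mono) auto
    also have "\<dots> < (m * m) * m" using that \<open>z \<noteq> m\<close> by auto
    finally show False using that by (simp add: mult_ac)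
  qed
  have gle: "gcd k x \<le> k" if "k > 0" for k x :: nat using that by (simp add: gcd_le1_nat)
  have "a3 * (a3 * a3) = gcd a3 b1 * (gcd a3 b2 * gcd a3 b3)"
    using tors[of a3] dvd dvd_trans[OF dvd(2,1)] by (simp add: gcd_nat.absorb1)
  then have "gcd a3 b3 = a3" using max3[of "gcd a3 b1" "gcd a3 b2" "gcd a3 b3" a3] pos gle by simp
  then show "a3 dvd b3" by (metis gcd_dvd2)
  assume eq: "a3 = b3"
  have "a2 * (a2 * a3) = gcd a2 b1 * (gcd a2 b2 * a3)"
    using tors[of a2] dvd eq pos by (simp add: gcd_nat.absorb1 gcd_nat.absorb2)
  then have "gcd a2 b1 * gcd a2 b2 = a2 * a2" using pos by (simp add: mult_ac)
  \<comment> \<open>A factor \<open>a2\<close> is added on both sides so that the bound for three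
    factors covers a product of two.\<close>
  then have "gcd a2 b2 = a2" using max3[of a2 "gcd a2 b1" "gcd a2 b2" a2] pos gle by simp
  then show "a2 dvd b2" by (metis gcd_dvd2)
qed

section \<open>The additive group of R and the cotype of its subgroups\<close>

lemma group_R_group [simp]: "group R_group"
  by (simp add: R_group_def DirProd_group)

lemma carrier_R_group [simp]: "carrier R_group = UNIV"
  by (simp add: R_group_def)

lemma one_R_group [simp]: "\<one>\<^bsub>R_group\<^esub> = (0, 0, 0)"
  by (simp add: R_group_def)

lemma mult_R_group [simp]: "(x, y, z) \<otimes>\<^bsub>R_group\<^esub> (x', y', z') = (x + x', y + y', z + z')"
  by (simp add: R_group_def)

lemma inv_R_group [simp]: "inv\<^bsub>R_group\<^esub> (x, y, z) = (-x, -y, -z)"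
  by (rule group.inv_equality[OF group_R_group]) auto

lemma comm_group_R_group: "comm_group R_group"
  by (rule group.group_comm_groupI) (auto simp: add.commute)

lemma normal_R_group: "subgroup S R_group \<Longrightarrow> S \<lhd> R_group"
  by (simp add: comm_group.subgroup_imp_normal comm_group_R_group)

lemma has_cotype_unique:
  assumes S: "subgroup S R_group" and a: "has_cotype S a1 a2 a3" and b: "has_cotype S b1 b2 b3"
  shows "a1 = b1 \<and> a2 = b2 \<and> a3 = b3"
proof -
  have grp: "group (R_group Mod S)"
    using normal.factorgroup_is_group[OF normal_R_group[OF S]] .
  have iso: "cotype_group a1 a2 a3 \<cong> cotype_group b1 b2 b3"
    using a b grp unfolding has_cotype_def by (meson group.iso_sym iso_trans)
  then have iso': "cotype_group b1 b2 b3 \<cong> cotype_group a1 a2 a3"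
    using group.iso_sym[OF group_cotype_group] by blast
  have dvd: "a1 > 0" "a2 > 0" "a3 > 0" "b1 > 0" "b2 > 0" "b3 > 0"
    "a2 dvd a1" "a3 dvd a2" "b2 dvd b1" "b3 dvd b2"
    using a b by (simp_all only: has_cotype_def)
  have a3: "a3 = b3"
    by (rule dvd_antisym; rule iso_cotype_group_dvd(1)) (fact dvd iso iso')+
  have a2: "a2 = b2"
    by (rule dvd_antisym; rule iso_cotype_group_dvd(2)) (fact dvd iso iso' a3 a3[symmetric])+
  \<comment> \<open>The remaining equality \<open>a1 = b1\<close> comes from comparing
    orders.\<close>
  obtain h where "bij_betw h (carrier (cotype_group a1 a2 a3)) (carrier (cotype_group b1 b2 b3))"
    using iso unfolding is_iso_def iso_def by blast
  then have "card (carrier (cotype_group a1 a2 a3)) = card (carrier (cotype_group b1 b2 b3))"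
    by (rule bij_betw_same_card)
  then have "a1 = b1"
    using a b a2 a3 by (simp add: has_cotype_def carrier_integer_mod_group card_cartesian_product)
  with a2 a3 show ?thesis by simp
qed

lemma alpha_eq:
  assumes "subgroup S R_group" "has_cotype S a1 a2 a3"
  shows "alpha1 S = a1" "alpha2 S = a2"
proof -
  have "cotype S = (a1, a2, a3)"
    unfolding cotype_def
  proof (rule the_equality)
    fix w assume "case w of (b1, b2, b3) \<Rightarrow> has_cotype S b1 b2 b3"
    then show "w = (a1, a2, a3)"
      using has_cotype_unique[OF assms(1) _ assms(2)] by (cases w) blast
  qed (use assms(2) in simp)
  then show "alpha1 S = a1" "alpha2 S = a2" by (auto simp: alpha1_def alpha2_def)
qed

text \<open>Reducing the coordinates of \<open>f\<close> modulo \<open>m\<close> and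
  \<open>n\<close> gives a surjection onto the cotype group with kernel \<open>S\<close>, and the
  first isomorphism theorem applies. The charts below are instances.\<close>

lemma surj_hom_cotype:
  fixes f :: "int \<times> int \<times> int \<Rightarrow> int \<times> int" and m n :: nat
  assumes hom: "f \<in> hom R_group (integer_group \<times>\<times> integer_group)" and surj: "surj f"
    and mn: "m > 0" "n > 0" "n dvd m"
  defines "S \<equiv> {v. int m dvd fst (f v) \<and> int n dvd snd (f v)}"
  shows "subgroup S R_group" "has_cotype S m n 1" "finite (carrier (R_group Mod S))" "R_index S = m * n"
proof -
  define h where "h v = (fst (f v) mod int m, snd (f v) mod int n, 0::int)" for v
  have "h \<in> hom R_group (cotype_group m n 1)"
  proof (rule homI)
    fix v w
    have "f (v \<otimes>\<^bsub>R_group\<^esub> w) = f v \<otimes>\<^bsub>integer_group \<times>\<times> integer_group\<^esub> f w"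
      using hom_mult[OF hom] by simp
    then show "h (v \<otimes>\<^bsub>R_group\<^esub> w) = h v \<otimes>\<^bsub>cotype_group m n 1\<^esub> h w"
      by (simp add: h_def mult_DirProd' mod_add_eq)
  qed (use mn in \<open>auto simp: h_def carrier_integer_mod_group\<close>)
  then interpret group_hom R_group "cotype_group m n 1" h
    using group_cotype_group by (auto simp: group_hom_def group_hom_axioms_def)
  have ker: "kernel R_group (cotype_group m n 1) h = S"
    by (auto simp: kernel_def S_def h_def mod_eq_0_iff_dvd)
  show "subgroup S R_group" using subgroup_kernel unfolding ker .
  have "h ` carrier R_group = carrier (cotype_group m n 1)"
  proof (intro equalityI subsetI)
    show "w \<in> carrier (cotype_group m n 1)" if "w \<in> h ` carrier R_group" for w
      using that hom_closed by blast
  next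
    fix w assume w: "w \<in> carrier (cotype_group m n 1)"
    obtain i j k where ijk: "w = (i, j, k)" by (cases w)
    obtain v where "f v = (i, j)" using surj by (metis surjD)
    then have "h v = w" using w mn by (auto simp: ijk h_def carrier_integer_mod_group)
    then show "w \<in> h ` carrier R_group" by auto
  qed
  then have iso: "(R_group Mod S) \<cong> cotype_group m n 1" using FactGroup_iso unfolding ker by blast
  then show "has_cotype S m n 1" using mn by (simp add: has_cotype_def)
  obtain g where g: "bij_betw g (carrier (R_group Mod S)) (carrier (cotype_group m n 1))"
    using iso unfolding is_iso_def iso_def by blast
  have fin: "finite (carrier (cotype_group m n 1))" and card: "card (carrier (cotype_group m n 1)) = m * n"
    using mn by (simp_all add: carrier_integer_mod_group card_cartesian_product)
  show "finite (carrier (R_group Mod S))" using g fin bij_betw_finite by blast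
  show "R_index S = m * n" unfolding R_index_def using bij_betw_same_card[OF g] card by simp
qed

subsection \<open>Lattices of prime power index in the plane\<close>

lemma prime_power_dvd_iff:
  fixes q :: int
  assumes "prime q"
  shows "q ^ m dvd q ^ n \<longleftrightarrow> m \<le> n"
  using assms not_prime_unit by (auto simp: dvd_power_iff)

text \<open>The least power of \<open>q\<close> in \<open>J\<close> generates it: by Bezout its gcd
  with any element of \<open>J\<close> is again in \<open>J\<close>, and that gcd is a power of
  \<open>q\<close>.\<close>

lemma int_subgroup_prime_power:
  fixes q :: int
  assumes q: "prime q" and add: "\<And>x y. x \<in> J \<Longrightarrow> y \<in> J \<Longrightarrow> x + y \<in> J"
    and scale: "\<And>k x. x \<in> J \<Longrightarrow> k * x \<in> J" and N: "q ^ N \<in> J"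
  shows "\<exists>k. J = {y. q ^ k dvd y}"
proof -
  define k where "k = (LEAST k. q ^ k \<in> J)"
  have k: "q ^ k \<in> J" unfolding k_def using N by (rule LeastI)
  have least: "k \<le> j" if "q ^ j \<in> J" for j unfolding k_def using that by (rule Least_le)
  have "q ^ k dvd y" if y: "y \<in> J" for y
  proof -
    obtain s t where st: "s * y + t * q ^ k = gcd y (q ^ k)" using bezout_int by blast
    then have g: "gcd y (q ^ k) \<in> J" using add scale y k by metis
    have "gcd y (q ^ k) dvd q ^ k" by simp
    then obtain j where "normalize (gcd y (q ^ k)) = q ^ j" by (rule divides_primepow[OF q])
    then have gj: "gcd y (q ^ k) = q ^ j" by simp
    then have "k \<le> j" using g least by simp
    then show "q ^ k dvd y" using gj by (metis gcd_dvd1 le_imp_power_dvd dvd_trans)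
  qed
  moreover have "y \<in> J" if "q ^ k dvd y" for y
    using that scale k by (metis dvd_div_mult_self)
  ultimately show ?thesis by auto
qed

text \<open>This is a Hermite normal form: a vector whose first coordinate has the minimal valuation
  \<open>b\<close> yields a pivot with first coordinate \<open>q ^ b\<close>, and subtracting
  multiples of it reduces membership to vectors \<open>(0, y)\<close>.\<close>

lemma lattice_pivot:
  fixes q :: int
  assumes q: "prime q"
    and add: "\<And>x y x' y'. (x, y) \<in> T \<Longrightarrow> (x', y') \<in> T \<Longrightarrow> (x + x', y + y') \<in> T"
    and scale: "\<And>k x y. (x, y) \<in> T \<Longrightarrow> (k * x, k * y) \<in> T"
    and N: "(q ^ N, 0) \<in> T" "(0, q ^ N) \<in> T"
    and b: "\<And>x y. (x, y) \<in> T \<Longrightarrow> q ^ b dvd x \<and> q ^ b dvd y"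
    and w: "(w1, w2) \<in> T" "\<not> q ^ (b + 1) dvd w1"
  shows "\<exists>n u. 0 \<le> u \<and> u < q ^ n \<and> T = {(x, y). q ^ b dvd x \<and> q ^ (n + b) dvd y + u * x}"
proof -
  have q0: "q > 0" using prime_gt_0_int[OF q] .
  obtain r1 r2 where r: "w1 = q ^ b * r1" "w2 = q ^ b * r2" using b[OF w(1)] by (auto elim!: dvdE)
  have "\<not> q dvd r1" using w(2) by (auto simp: r)
  \<comment> \<open>The inverse \<open>s\<close> of \<open>r1\<close> modulo \<open>q ^ N\<close>
    turns the first coordinate into exactly \<open>q ^ b\<close>, the error being absorbed by
    \<open>(q ^ N, 0)\<close>.\<close>
  then have "coprime r1 (q ^ N)" using q by (metis coprime_commute coprime_power_right_iff prime_imp_coprime)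
  then obtain s t where st: "s * r1 + t * q ^ N = 1" using bezout_int[of r1 "q ^ N"] by auto
  have "(s * w1 + (t * q ^ b) * q ^ N, s * w2 + (t * q ^ b) * 0) \<in> T"
    by (intro add scale w N)
  moreover have "s * w1 + (t * q ^ b) * q ^ N = q ^ b"
  proof -
    have "s * w1 + (t * q ^ b) * q ^ N = q ^ b * (s * r1 + t * q ^ N)" by (simp add: r algebra_simps)
    then show ?thesis by (simp add: st)
  qed
  ultimately have p0: "(q ^ b, q ^ b * (s * r2)) \<in> T" by (simp add: r mult_ac)
  have "\<exists>k. {y. (0, y) \<in> T} = {y. q ^ k dvd y}"
  proof (rule int_subgroup_prime_power[OF q])
    show "x + y \<in> {y. (0, y) \<in> T}" if "x \<in> {y. (0, y) \<in> T}" "y \<in> {y. (0, y) \<in> T}" for x y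
      using add[of 0 x 0 y] that by simp
    show "k * x \<in> {y. (0, y) \<in> T}" if "x \<in> {y. (0, y) \<in> T}" for k x
      using scale[of 0 x k] that by simp
  qed (use N in auto)
  then obtain k where k: "\<And>y. (0, y) \<in> T \<longleftrightarrow> q ^ k dvd y" by auto
  have "b \<le> k"
    using b[of 0 "q ^ k"] k[of "q ^ k"] by (simp add: prime_power_dvd_iff[OF q])
  then obtain n where n: "k = n + b" by (metis add.commute le_Suc_ex)
  \<comment> \<open>Multiples of \<open>(0, q ^ (n + b))\<close> may be added to the pivot, so its
    slope matters only modulo \<open>q ^ n\<close>; the sign is chosen to give the form
    \<open>y + u * x\<close>.\<close>
  define u where "u = (- (s * r2)) mod q ^ n"
  define c where "c = (- (s * r2)) div q ^ n"
  have uc: "- (s * r2) = c * q ^ n + u" by (simp only: u_def c_def div_mult_mod_eq)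
  have u: "0 \<le> u" "u < q ^ n" using q0 by (simp_all add: u_def)
  have "(0, q ^ (n + b)) \<in> T" using k by (simp add: n)
  then have "(q ^ b + c * 0, q ^ b * (s * r2) + c * q ^ (n + b)) \<in> T"
    by (intro add scale p0)
  moreover have "q ^ b * (s * r2) + c * q ^ (n + b) = - (u * q ^ b)"
  proof -
    have "q ^ b * (s * r2) + c * q ^ (n + b) = q ^ b * (- (- (s * r2)) + c * q ^ n)"
      by (simp add: power_add algebra_simps)
    then show ?thesis unfolding uc by simp
  qed
  ultimately have p: "(q ^ b, - (u * q ^ b)) \<in> T" by simp
  \<comment> \<open>Subtracting \<open>x'\<close> times the pivot clears the first
    coordinate.\<close>
  have iff: "(x' * q ^ b, y) \<in> T \<longleftrightarrow> q ^ (n + b) dvd y + u * (x' * q ^ b)" for x' y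
  proof -
    have "(x' * q ^ b, y) \<in> T \<longleftrightarrow> (0, y + u * (x' * q ^ b)) \<in> T"
      using add[OF scale[OF p, of "- x'"], of "x' * q ^ b" y] 
        add[OF scale[OF p, of "x'"], of 0 "y + u * (x' * q ^ b)"]
      by (auto simp: algebra_simps)
    then show ?thesis by (simp add: k n)
  qed
  have "T = {(x, y). q ^ b dvd x \<and> q ^ (n + b) dvd y + u * x}"
  proof -
    have "(x, y) \<in> T \<longleftrightarrow> q ^ b dvd x \<and> q ^ (n + b) dvd y + u * x" for x y
    proof (cases "q ^ b dvd x")
      case True
      then obtain x' where "x = x' * q ^ b" by (metis dvd_div_mult_self)
      then show ?thesis using iff by simp
    qed (use b in blast)
    then show ?thesis by auto
  qed
  with u show ?thesis by blast
qed

text \<open>The two affine charts of the projective line over \<open>Z/p\<^sup>n\<close>, \<open>n = a - b\<close>. If \<open>b \<le> a\<close>,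
  the second coordinate in the first chart and the first one in the second are divisible by \<open>p\<^sup>b\<close> too.\<close>

definition chart_A :: "nat \<Rightarrow> nat \<Rightarrow> nat \<Rightarrow> int \<Rightarrow> (int \<times> int \<times> int) set" where
  "chart_A p a b u = {(x, y, z). int p ^ b dvd x \<and> int p ^ a dvd y + u * x}"

definition chart_B :: "nat \<Rightarrow> nat \<Rightarrow> nat \<Rightarrow> int \<Rightarrow> (int \<times> int \<times> int) set" where
  "chart_B p a b v = {(x, y, z). int p ^ b dvd y \<and> int p ^ a dvd x + v * y}"

text \<open>As 1 lies in \<open>S\<close>, only the plane part \<open>T\<close> matters. Let
  \<open>q ^ b\<close> be the largest power dividing all of \<open>T\<close>. If some first
  coordinate is not divisible by \<open>q ^ (b + 1)\<close>, it serves as pivot in the first chart.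
  Otherwise the coordinates are swapped, and the failure of the first case gives
  \<open>p dvd u\<close> and \<open>1 \<le> n\<close>.\<close>

lemma prime_power_index_subring_cases:
  assumes p: "prime p" and S: "is_subring S" and idx: "R_index S = p ^ k"
  shows "\<exists>n b u. 0 \<le> u \<and> u < int p ^ n \<and>
    (S = chart_A p (n + b) b u \<or> 1 \<le> n \<and> int p dvd u \<and> S = chart_B p (n + b) b u)"
proof -
  define q where "q = int p"
  have q: "prime q" using p by (simp add: q_def)
  then have q0: "q > 0" by (rule prime_gt_0_int)
  have sub: "subgroup S R_group" and one: "(0, 0, 1) \<in> S"
    using S by (auto simp: is_subring_def R_one_def)
  interpret subgroup S R_group by (rule sub)
  interpret N: normal S R_group by (rule normal_R_group[OF sub])
  have add: "(x + x', y + y', z + z') \<in> S" if "(x, y, z) \<in> S" "(x', y', z') \<in> S" for x y z x' y' z'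
    using m_closed[OF that] by simp
  have scale_nat: "(int j * x, int j * y, int j * z) \<in> S" if "(x, y, z) \<in> S" for j x y z
  proof (induction j)
    case 0 then show ?case using one_closed by simp
  next
    case (Suc j) then show ?case using add[OF that Suc] by (simp add: algebra_simps)
  qed
  have scale: "(j * x, j * y, j * z) \<in> S" if "(x, y, z) \<in> S" for j x y z
  proof (cases "j \<ge> 0")
    case True then show ?thesis using scale_nat[OF that, of "nat j"] by simp
  next
    case False then show ?thesis
      using m_inv_closed[OF scale_nat[OF that, of "nat (- j)"]] by simp
  qed
  define T where "T = {(x, y). (x, y, 0) \<in> S}"
  have ST: "(x, y, z) \<in> S \<longleftrightarrow> (x, y) \<in> T" for x y z
    using add[OF scale[OF one, of z], of x y 0] add[OF scale[OF one, of "- z"], of x y z]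
    by (auto simp: T_def)
  have Tadd: "(x + x', y + y') \<in> T" if "(x, y) \<in> T" "(x', y') \<in> T" for x y x' y'
    using add[of x y 0 x' y' 0] that by (simp add: T_def)
  have Tscale: "(j * x, j * y) \<in> T" if "(x, y) \<in> T" for j x y
    using scale[of x y 0 j] that by (simp add: T_def)
  \<comment> \<open>The order \<open>p ^ k\<close> of the quotient annihilates it; this puts
    \<open>(q ^ k, 0)\<close> and \<open>(0, q ^ k)\<close> into \<open>T\<close> and bounds
    \<open>b\<close> by \<open>k\<close>.\<close>
  have pow: "v [^]\<^bsub>R_group\<^esub> (p ^ k) \<in> S" for v
  proof -
    interpret Q: group "R_group Mod S" by (rule N.factorgroup_is_group)
    have "S #>\<^bsub>R_group\<^esub> v \<in> carrier (R_group Mod S)" by (simp add: carrier_FactGroup)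
    then have "(S #>\<^bsub>R_group\<^esub> v) [^]\<^bsub>R_group Mod S\<^esub> (p ^ k) = S"
      using Q.pow_order_eq_1 idx by (simp add: order_def R_index_def)
    then have "S #>\<^bsub>R_group\<^esub> (v [^]\<^bsub>R_group\<^esub> (p ^ k)) = S" by (simp add: N.FactGroup_pow)
    then show ?thesis using N.coset_join1[OF _ _ sub] by simp
  qed
  have pow_eq: "(x, y, z) [^]\<^bsub>R_group\<^esub> (j::nat) = (int j * x, int j * y, int j * z)" for x y z j
    by (simp add: R_group_def nat_pow_DirProd)
  have TN: "(q ^ k, 0) \<in> T" "(0, q ^ k) \<in> T"
    using pow[of "(1, 0, 0)"] pow[of "(0, 1, 0)"] by (simp_all add: pow_eq T_def q_def)
  define P where "P b \<longleftrightarrow> (\<forall>x y. (x, y) \<in> T \<longrightarrow> q ^ b dvd x \<and> q ^ b dvd y)" for b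
  have "P 0" by (simp add: P_def)
  moreover have "\<forall>b. P b \<longrightarrow> b \<le> k"
    using TN(1) prime_power_dvd_iff[OF q] unfolding P_def by blast
  ultimately have "P (GREATEST b. P b)" "\<And>c. P c \<Longrightarrow> c \<le> (GREATEST b. P b)"
    by (blast intro: GreatestI_nat Greatest_le_nat)+
  then obtain b where "P b" and max: "\<And>c. P c \<Longrightarrow> c \<le> b" by blast
  then have b: "q ^ b dvd x \<and> q ^ b dvd y" if "(x, y) \<in> T" for x y
    using that by (simp add: P_def)
  have "\<not> P (b + 1)" using max[of "b + 1"] by auto
  then obtain w1 w2 where w: "(w1, w2) \<in> T" "\<not> (q ^ (b + 1) dvd w1 \<and> q ^ (b + 1) dvd w2)"
    unfolding P_def by blast
  show ?thesis
  proof (cases "\<exists>w1 w2. (w1, w2) \<in> T \<and> \<not> q ^ (b + 1) dvd w1")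
    case True
    then obtain v1 v2 where "(v1, v2) \<in> T" "\<not> q ^ (b + 1) dvd v1" by blast
    then obtain n u where nu: "0 \<le> u" "u < q ^ n"
      and T: "T = {(x, y). q ^ b dvd x \<and> q ^ (n + b) dvd y + u * x}"
      using lattice_pivot[OF q Tadd Tscale TN b] by blast
    have "S = chart_A p (n + b) b u"
      using ST T by (auto simp: chart_A_def q_def)
    with nu show ?thesis by (auto simp: q_def)
  next
    case False
    then have dvd1: "q ^ (b + 1) dvd x" if "(x, y) \<in> T" for x y using that by blast
    define T' where "T' = {(y, x). (x, y) \<in> T}"
    have "\<exists>n u. 0 \<le> u \<and> u < q ^ n \<and> T' = {(x, y). q ^ b dvd x \<and> q ^ (n + b) dvd y + u * x}"
    proof (rule lattice_pivot[OF q])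
      show "(w2, w1) \<in> T'" "\<not> q ^ (b + 1) dvd w2"
        using w False by (auto simp: T'_def)
      show "q ^ b dvd x \<and> q ^ b dvd y" if "(x, y) \<in> T'" for x y
        using that b[of y x] by (simp add: T'_def)
    qed (use Tadd Tscale TN in \<open>simp_all add: T'_def\<close>)
    then obtain n u where nu: "0 \<le> u" "u < q ^ n"
      and T': "T' = {(x, y). q ^ b dvd x \<and> q ^ (n + b) dvd y + u * x}" by blast
    have T: "(x, y) \<in> T \<longleftrightarrow> q ^ b dvd y \<and> q ^ (n + b) dvd x + u * y" for x y
      using T' by (auto simp: T'_def set_eq_iff)
    \<comment> \<open>The pivot \<open>(- (u * q ^ b), q ^ b)\<close> lies in \<open>T\<close>,
      where all first coordinates are divisible by \<open>q ^ (b + 1)\<close>.\<close>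
    have "q ^ (b + 1) dvd - (u * q ^ b)" using dvd1[of "- (u * q ^ b)" "q ^ b"] by (simp add: T)
    then have "q dvd u" using q0 by simp
    moreover have "n \<noteq> 0"
    proof
      assume "n = 0"
      then have "(q ^ b, 0) \<in> T" by (simp add: T)
      then have "q ^ (b + 1) dvd q ^ b" by (rule dvd1)
      then have "b + 1 \<le> b" by (simp only: prime_power_dvd_iff[OF q])
      then show False by simp
    qed
    moreover have "S = chart_B p (n + b) b u"
      using ST T by (auto simp: chart_B_def q_def)
    ultimately show ?thesis using nu by (auto simp: q_def Suc_le_eq)
  qed
qed

section \<open>Cotype of the charts, and when they are closed under multiplication\<close>

lemma chart_A_cotype:
  assumes "p > 0" "b \<le> a"
  shows "subgroup (chart_A p a b u) R_group" "has_cotype (chart_A p a b u) (p ^ a) (p ^ b) 1"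
    "finite (carrier (R_group Mod chart_A p a b u))" "R_index (chart_A p a b u) = p ^ a * p ^ b"
proof -
  \<comment> \<open>A unimodular change of the plane coordinates makes the lattice diagonal.\<close>
  define f where "f = (\<lambda>(x, y, z::int). (y + u * x, x))"
  have hom: "f \<in> hom R_group (integer_group \<times>\<times> integer_group)"
    by (rule homI) (auto simp: f_def algebra_simps)
  have surj: "surj f"
    by (rule surjI[of _ "\<lambda>(s, t). (t, s - u * t, 0)"]) (auto simp: f_def)
  have S: "chart_A p a b u = {v. int (p ^ a) dvd fst (f v) \<and> int (p ^ b) dvd snd (f v)}"
    by (auto simp: chart_A_def f_def)
  have pos: "p ^ a > 0" "p ^ b > 0" "p ^ b dvd p ^ a" using assms by (auto intro: le_imp_power_dvd)
  show "subgroup (chart_A p a b u) R_group" "has_cotype (chart_A p a b u) (p ^ a) (p ^ b) 1"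
    "finite (carrier (R_group Mod chart_A p a b u))" "R_index (chart_A p a b u) = p ^ a * p ^ b"
    unfolding S by (fact surj_hom_cotype[OF hom surj pos])+
qed

lemma chart_B_cotype:
  assumes "p > 0" "b \<le> a"
  shows "subgroup (chart_B p a b v) R_group" "has_cotype (chart_B p a b v) (p ^ a) (p ^ b) 1"
    "finite (carrier (R_group Mod chart_B p a b v))" "R_index (chart_B p a b v) = p ^ a * p ^ b"
proof -
  define f where "f = (\<lambda>(x, y, z::int). (x + v * y, y))"
  have hom: "f \<in> hom R_group (integer_group \<times>\<times> integer_group)"
    by (rule homI) (auto simp: f_def algebra_simps)
  have surj: "surj f"
    by (rule surjI[of _ "\<lambda>(s, t). (s - v * t, t, 0)"]) (auto simp: f_def)
  have S: "chart_B p a b v = {w. int (p ^ a) dvd fst (f w) \<and> int (p ^ b) dvd snd (f w)}"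
    by (auto simp: chart_B_def f_def)
  have pos: "p ^ a > 0" "p ^ b > 0" "p ^ b dvd p ^ a" using assms by (auto intro: le_imp_power_dvd)
  show "subgroup (chart_B p a b v) R_group" "has_cotype (chart_B p a b v) (p ^ a) (p ^ b) 1"
    "finite (carrier (R_group Mod chart_B p a b v))" "R_index (chart_B p a b v) = p ^ a * p ^ b"
    unfolding S by (fact surj_hom_cotype[OF hom surj pos])+
qed

text \<open>The pivot squares to \<open>(u ^ 2 * q ^ (2 * b), 0, 0)\<close>, which meets the
  congruence exactly when \<open>q ^ n\<close> divides \<open>u ^ 3 * q ^ b\<close>. Conversely,
  modulo \<open>q ^ (n + b)\<close> the term \<open>u * (y * y')\<close> of a product is congruent
  to \<open>u ^ 3 * x * x'\<close>.\<close>

lemma is_subring_chart_A: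
  assumes "p > 0"
  shows "is_subring (chart_A p (n + b) b u) \<longleftrightarrow> int p ^ n dvd u ^ 3 * int p ^ b"
proof
  define q where "q = int p"
  have q0: "q \<noteq> 0" using assms by (simp add: q_def)
  assume "is_subring (chart_A p (n + b) b u)"
  moreover have "(q ^ b, - (u * q ^ b), 0) \<in> chart_A p (n + b) b u"
    by (simp add: chart_A_def q_def)
  ultimately have "R_mult (q ^ b, - (u * q ^ b), 0) (q ^ b, - (u * q ^ b), 0) \<in> chart_A p (n + b) b u"
    unfolding is_subring_def by blast
  then have "q ^ b * q ^ n dvd q ^ b * (u ^ 3 * q ^ b)"
    by (simp add: chart_A_def q_def[symmetric] power_add power3_eq_cube mult_ac)
  then show "int p ^ n dvd u ^ 3 * int p ^ b" using q0 by (simp add: q_def)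
next
  define q where "q = int p"
  assume "int p ^ n dvd u ^ 3 * int p ^ b"
  then have dvd: "q ^ (n + b) dvd (u ^ 3 * q ^ b) * q ^ b"
    by (simp add: q_def power_add mult_dvd_mono)
  have closed: "R_mult v w \<in> chart_A p (n + b) b u"
    if vw: "v \<in> chart_A p (n + b) b u" "w \<in> chart_A p (n + b) b u" for v w
  proof -
    obtain x y z x' y' z' where eq: "v = (x, y, z)" "w = (x', y', z')" by (cases v; cases w)
    have 1: "q ^ b dvd x" "q ^ (n + b) dvd y + u * x" "q ^ b dvd x'" "q ^ (n + b) dvd y' + u * x'"
      using vw by (auto simp: eq chart_A_def q_def)
    have "q ^ b dvd y + u * x" using 1(2) by (rule dvd_trans[rotated]) (simp add: le_imp_power_dvd)
    then have y: "q ^ b dvd y" using 1(1) by (simp add: dvd_add_left_iff)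
    obtain r r' where r: "x = q ^ b * r" "x' = q ^ b * r'" using 1 by (auto elim!: dvdE)
    have "q ^ (n + b) dvd (u ^ 3 * q ^ b) * q ^ b * (r * r')"
      using dvd by (rule dvd_mult2)
    then have 2: "q ^ (n + b) dvd u * (u * x) * (u * x')"
      by (simp add: r power3_eq_cube mult_ac)
    \<comment> \<open>Expansion around \<open>y = - u * x\<close> and \<open>y' = - u * x'\<close>;
      the first two terms are divisible by \<open>q ^ (n + b)\<close>.\<close>
    have "u * (y * y') = (y + u * x) * (u * y') - (y' + u * x') * (u * (u * x)) + u * (u * x) * (u * x')"
      by (simp add: algebra_simps)
    then have 3: "q ^ (n + b) dvd u * (y * y')"
      using 1 2 by (simp add: dvd_add dvd_diff)
    have "(y * z' + z * y') + u * (x * z' + z * x' + y * y') =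
        (y + u * x) * z' + (y' + u * x') * z + u * (y * y')"
      by (simp add: algebra_simps)
    then have "q ^ (n + b) dvd (y * z' + z * y') + u * (x * z' + z * x' + y * y')"
      using 1 3 by (simp add: dvd_add)
    then show ?thesis using 1 y by (simp add: eq chart_A_def q_def)
  qed
  show "is_subring (chart_A p (n + b) b u)"
    using chart_A_cotype[OF assms, of b "n + b" u] closed
    by (auto simp: is_subring_def R_one_def chart_A_def)
qed

text \<open>Here the pivot squares to \<open>(q ^ (2 * b), 0, 0)\<close> whatever \<open>v\<close>
  is, which compares \<open>n + b\<close> with \<open>2 * b\<close>. Conversely \<open>q ^ b\<close>
  divides both \<open>y\<close> and \<open>y'\<close>.\<close>

lemma is_subring_chart_B:
  assumes "prime p"
  shows "is_subring (chart_B p (n + b) b v) \<longleftrightarrow> n \<le> b"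
proof
  define q where "q = int p"
  assume "is_subring (chart_B p (n + b) b v)"
  moreover have "(- (v * q ^ b), q ^ b, 0) \<in> chart_B p (n + b) b v"
    by (simp add: chart_B_def q_def)
  ultimately have "R_mult (- (v * q ^ b), q ^ b, 0) (- (v * q ^ b), q ^ b, 0) \<in> chart_B p (n + b) b v"
    unfolding is_subring_def by blast
  then have "q ^ (n + b) dvd q ^ (b + b)"
    by (simp add: chart_B_def q_def power_add)
  then show "n \<le> b" using assms prime_power_dvd_iff[of q] by (simp add: q_def)
next
  define q where "q = int p"
  assume "n \<le> b"
  then have dvd: "q ^ (n + b) dvd q ^ b * q ^ b"
    by (simp add: le_imp_power_dvd flip: power_add)
  have p0: "p > 0" using assms by (rule prime_gt_0_nat)
  have closed: "R_mult w w' \<in> chart_B p (n + b) b v"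
    if vw: "w \<in> chart_B p (n + b) b v" "w' \<in> chart_B p (n + b) b v" for w w'
  proof -
    obtain x y z x' y' z' where eq: "w = (x, y, z)" "w' = (x', y', z')" by (cases w; cases w')
    have 1: "q ^ b dvd y" "q ^ (n + b) dvd x + v * y" "q ^ b dvd y'" "q ^ (n + b) dvd x' + v * y'"
      using vw by (auto simp: eq chart_B_def q_def)
    have 2: "q ^ (n + b) dvd y * y'" using dvd mult_dvd_mono[OF 1(1,3)] by (rule dvd_trans)
    have sum: "(x * z' + z * x' + y * y') + v * (y * z' + z * y') =
        (x + v * y) * z' + (x' + v * y') * z + y * y'"
      by (simp add: algebra_simps)
    have "q ^ (n + b) dvd (x * z' + z * x' + y * y') + v * (y * z' + z * y')"
      unfolding sum by (rule dvd_add[OF dvd_add[OF dvd_mult2[OF 1(2)] dvd_mult2[OF 1(4)]] 2])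
    then show ?thesis using 1 by (simp add: eq chart_B_def q_def)
  qed
  show "is_subring (chart_B p (n + b) b v)"
    using chart_B_cotype[OF p0, of b "n + b" v] closed
    by (auto simp: is_subring_def R_one_def chart_B_def)
qed

section \<open>Distinctness of the charts and the number of admissible parameters\<close>

lemma residue_eqI:
  fixes m u v :: int
  assumes "0 \<le> u" "u < m" "0 \<le> v" "v < m" "m dvd u - v"
  shows "u = v"
  using assms by (metis mod_eq_dvd_iff mod_pos_pos_trivial)

text \<open>The pivot for \<open>v\<close> lies in the chart for \<open>u\<close> only if
  \<open>p ^ n\<close> divides \<open>u - v\<close>.\<close>

lemma chart_A_inj:
  assumes "p > 0"
  shows "inj_on (chart_A p (n + b) b) {0..<int p ^ n}"
proof (rule inj_onI)
  fix u v
  assume u: "u \<in> {0..<int p ^ n}" and v: "v \<in> {0..<int p ^ n}"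
    and eq: "chart_A p (n + b) b u = chart_A p (n + b) b v"
  have "(int p ^ b, - (v * int p ^ b), 0) \<in> chart_A p (n + b) b u"
    unfolding eq by (simp add: chart_A_def)
  then have "int p ^ b * int p ^ n dvd int p ^ b * (u - v)"
    by (simp add: chart_A_def power_add algebra_simps)
  then have "int p ^ n dvd u - v" using assms by simp
  then show "u = v" using u v by (intro residue_eqI[of _ "int p ^ n"]) auto
qed

lemma chart_B_inj:
  assumes "p > 0"
  shows "inj_on (chart_B p (n + b) b) {0..<int p ^ n}"
proof (rule inj_onI)
  fix u v
  assume u: "u \<in> {0..<int p ^ n}" and v: "v \<in> {0..<int p ^ n}"
    and eq: "chart_B p (n + b) b u = chart_B p (n + b) b v"
  have "(- (v * int p ^ b), int p ^ b, 0) \<in> chart_B p (n + b) b u"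
    unfolding eq by (simp add: chart_B_def)
  then have "int p ^ b * int p ^ n dvd int p ^ b * (u - v)"
    by (simp add: chart_B_def power_add algebra_simps)
  then have "int p ^ n dvd u - v" using assms by simp
  then show "u = v" using u v by (intro residue_eqI[of _ "int p ^ n"]) auto
qed

text \<open>A pivot of the first chart lying in the second would make \<open>v * u\<close> congruent
  to 1 modulo \<open>p ^ n\<close>, although \<open>p\<close> divides \<open>v\<close>.\<close>

lemma chart_A_neq_chart_B:
  assumes p: "prime p" and n: "1 \<le> n" and v: "int p dvd v"
  shows "chart_A p (n + b) b u \<noteq> chart_B p (n + b) b v"
proof
  assume eq: "chart_A p (n + b) b u = chart_B p (n + b) b v"
  have p0: "p > 0" using p by (rule prime_gt_0_nat)
  have "(int p ^ b, - (u * int p ^ b), 0) \<in> chart_B p (n + b) b v"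
    unfolding eq[symmetric] by (simp add: chart_A_def)
  then have "int p ^ b * int p ^ n dvd int p ^ b * (1 - v * u)"
    by (simp add: chart_B_def power_add algebra_simps)
  then have "int p ^ n dvd 1 - v * u" using p0 by simp
  then have "int p dvd 1 - v * u" using n by (metis dvd_power dvd_trans less_le_trans zero_less_one)
  moreover have "int p dvd v * u" using v by simp
  ultimately have "int p dvd 1" by (metis diff_add_cancel dvd_add)
  then show False using p by auto
qed

text \<open>In valuations the left side reads \<open>n \<le> 3 * multiplicity q u + b\<close>. The
  exponent on the right is the ceiling of \<open>(n - b) / 3\<close>; truncated subtraction makes it
  0 when \<open>n \<le> b\<close>.\<close>

lemma cube_dvd_iff:
  fixes q u :: int
  assumes q: "prime q"
  shows "q ^ n dvd u ^ 3 * q ^ b \<longleftrightarrow> q ^ ((n - b + 2) div 3) dvd u"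
proof (cases "u = 0")
  case False
  have nu: "\<not> is_unit q" "q \<noteq> 0" using q not_prime_unit by auto
  have u3: "u ^ 3 * q ^ b \<noteq> 0" using False nu by simp
  have pe: "prime_elem q" using q by (rule prime_imp_prime_elem)
  have "multiplicity q (u ^ 3 * q ^ b) = multiplicity q (u ^ 3) + multiplicity q (q ^ b)"
    using False nu by (intro prime_elem_multiplicity_mult_distrib[OF pe]) auto
  also have "\<dots> = 3 * multiplicity q u + b"
    using prime_elem_multiplicity_power_distrib[OF pe False] multiplicity_same_power[OF nu(2,1)] by simp
  finally have "multiplicity q (u ^ 3 * q ^ b) = 3 * multiplicity q u + b" .
  then have "q ^ n dvd u ^ 3 * q ^ b \<longleftrightarrow> n \<le> 3 * multiplicity q u + b"
    using power_dvd_iff_le_multiplicity[OF u3 nu(1)] by simp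
  also have "\<dots> \<longleftrightarrow> (n - b + 2) div 3 \<le> multiplicity q u" by linarith
  also have "\<dots> \<longleftrightarrow> q ^ ((n - b + 2) div 3) dvd u"
    using power_dvd_iff_le_multiplicity[OF False nu(1)] by simp
  finally show ?thesis .
qed simp

lemma card_residues_dvd:
  assumes "p > 0" "c \<le> n"
  shows "card {x \<in> {0..<int p ^ n}. int p ^ c dvd x} = p ^ (n - c)"
proof -
  have "p ^ c * p ^ (n - c) = p ^ n" using assms by (simp flip: power_add)
  then show ?thesis using card_multiples[of "p ^ c" "p ^ (n - c)"] assms by simp
qed

subsection \<open>The number of subrings of given cotype\<close>

text \<open>With \<open>n = a - b\<close>, the first power counts the \<open>u\<close> modulo
  \<open>p ^ n\<close> that satisfy the cube condition, the second the multiples of \<open>p\<close>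
  modulo \<open>p ^ n\<close> in the second chart.\<close>

definition subring_count :: "nat \<Rightarrow> nat \<Rightarrow> nat \<Rightarrow> nat" where
  "subring_count p a b =
     (if b \<le> a then p ^ ((a - b) - ((a - b) - b + 2) div 3)
        + (if 1 \<le> a - b \<and> a - b \<le> b then p ^ (a - b - 1) else 0) else 0)"

lemma card_subrings:
  assumes p: "prime p"
  shows "card {S. is_subring S \<and> (\<exists>k. R_index S = p ^ k) \<and> alpha1 S = p ^ a \<and> alpha2 S = p ^ b}
    = subring_count p a b" (is "card ?M = _")
proof -
  have p0: "p > 0" and p1: "p > 1" using p prime_gt_0_nat prime_gt_1_nat by auto
  have alphaA: "alpha1 (chart_A p (n + c) c u) = p ^ (n + c)" "alpha2 (chart_A p (n + c) c u) = p ^ c" for n c u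
    using alpha_eq[OF chart_A_cotype(1,2)[OF p0, of c "n + c" u]] by auto
  have alphaB: "alpha1 (chart_B p (n + c) c u) = p ^ (n + c)" "alpha2 (chart_B p (n + c) c u) = p ^ c" for n c u
    using alpha_eq[OF chart_B_cotype(1,2)[OF p0, of c "n + c" u]] by auto
  have idxA: "\<exists>k. R_index (chart_A p (n + c) c u) = p ^ k" for n c u
    using chart_A_cotype(4)[OF p0, of c "n + c" u] by (metis le_add2 power_add)
  have idxB: "\<exists>k. R_index (chart_B p (n + c) c u) = p ^ k" for n c u
    using chart_B_cotype(4)[OF p0, of c "n + c" u] by (metis le_add2 power_add)
  have M: "S \<in> ?M \<longleftrightarrow> (\<exists>n u. a = n + b \<and> 0 \<le> u \<and> u < int p ^ n \<and>
      (S = chart_A p a b u \<and> int p ^ n dvd u ^ 3 * int p ^ b \<or>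
       1 \<le> n \<and> n \<le> b \<and> int p dvd u \<and> S = chart_B p a b u))" for S
  proof
    assume S: "S \<in> ?M"
    then obtain k where "is_subring S" "R_index S = p ^ k" by blast
    then obtain n c u where u: "0 \<le> u" "u < int p ^ n"
      and ch: "S = chart_A p (n + c) c u \<or> 1 \<le> n \<and> int p dvd u \<and> S = chart_B p (n + c) c u"
      using prime_power_index_subring_cases[OF p] by blast
    \<comment> \<open>The cotype of a chart determines its exponents, so only the parameter
      \<open>u\<close> remains free.\<close>
    then have "alpha1 S = p ^ (n + c)" "alpha2 S = p ^ c" using alphaA alphaB by auto
    then have "p ^ (n + c) = p ^ a" "p ^ c = p ^ b" using S by auto
    then have "a = n + b" "c = b" using p1 by auto
    then show "\<exists>n u. a = n + b \<and> 0 \<le> u \<and> u < int p ^ n \<and>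
      (S = chart_A p a b u \<and> int p ^ n dvd u ^ 3 * int p ^ b \<or>
       1 \<le> n \<and> n \<le> b \<and> int p dvd u \<and> S = chart_B p a b u)"
      using u ch \<open>is_subring S\<close> is_subring_chart_A[OF p0] is_subring_chart_B[OF p] by blast
  next
    assume "\<exists>n u. a = n + b \<and> 0 \<le> u \<and> u < int p ^ n \<and>
      (S = chart_A p a b u \<and> int p ^ n dvd u ^ 3 * int p ^ b \<or>
       1 \<le> n \<and> n \<le> b \<and> int p dvd u \<and> S = chart_B p a b u)"
    then obtain n u where a: "a = n + b" and ch: "S = chart_A p (n + b) b u \<and> int p ^ n dvd u ^ 3 * int p ^ b \<or>
       n \<le> b \<and> S = chart_B p (n + b) b u" by auto
    from ch have "is_subring S"
      using is_subring_chart_A[OF p0] is_subring_chart_B[OF p] by blast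
    moreover from ch have "\<exists>k. R_index S = p ^ k" using idxA idxB by blast
    moreover from ch have "alpha1 S = p ^ a" "alpha2 S = p ^ b" using alphaA alphaB a by auto
    ultimately show "S \<in> ?M" by blast
  qed
  show ?thesis
  proof (cases "b \<le> a")
    case False
    then have "?M = {}" using M by fastforce
    then show ?thesis using False by (simp only: card.empty subring_count_def if_False)
  next
    case True
    define n where "n = a - b"
    have a: "a = n + b" using True by (simp add: n_def)
    define c where "c = (n - b + 2) div 3"
    have c: "c \<le> n" unfolding c_def by linarith
    define U where "U = {u \<in> {0..<int p ^ n}. int p ^ c dvd u}"
    \<comment> \<open>The exponent 1 is written out to match \<open>card_residues_dvd\<close> with
      \<open>c = 1\<close>.\<close>
    define V where "V = (if 1 \<le> n \<and> n \<le> b then {u \<in> {0..<int p ^ n}. int p ^ 1 dvd u} else {})"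
    have cube: "int p ^ n dvd u ^ 3 * int p ^ b \<longleftrightarrow> int p ^ c dvd u" for u
      unfolding c_def by (rule cube_dvd_iff) (use p in simp)
    have "S \<in> ?M \<longleftrightarrow> S \<in> chart_A p a b ` U \<union> chart_B p a b ` V" for S
      unfolding M by (auto simp: a cube U_def V_def)
    then have eq: "?M = chart_A p a b ` U \<union> chart_B p a b ` V" by blast
    have "U \<subseteq> {0..<int p ^ n}" "V \<subseteq> {0..<int p ^ n}" by (auto simp: U_def V_def)
    then have fin: "finite U" "finite V" by (auto intro: finite_subset)
    have disj: "chart_A p a b ` U \<inter> chart_B p a b ` V = {}"
      using chart_A_neq_chart_B[OF p] by (auto simp: V_def a split: if_splits)
    have "inj_on (chart_A p a b) U" "inj_on (chart_B p a b) V"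
      unfolding a by (rule inj_on_subset[OF chart_A_inj[OF p0]] inj_on_subset[OF chart_B_inj[OF p0]];
        auto simp: U_def V_def)+
    then have "card ?M = card U + card V"
      unfolding eq using fin disj by (simp add: card_Un_disjoint card_image)
    also have "card U = p ^ (n - c)" unfolding U_def using p0 c by (rule card_residues_dvd)
    also have "card V = (if 1 \<le> n \<and> n \<le> b then p ^ (n - 1) else 0)"
      unfolding V_def using card_residues_dvd[OF p0, of 1 n] by simp
    finally show ?thesis using True by (simp add: subring_count_def n_def c_def)
  qed
qed

subsection \<open>The generating function\<close>

text \<open>A monomial shifts both indices, which is what makes each factor of the denominator a
  difference operator.\<close>

lemma fps_XY_mult_nth:
  "((of_nat c * fpsX ^ i * fpsY ^ j) * f) $ a $ b =
    (if i \<le> a \<and> j \<le> b then int c * f $ (a - i) $ (b - j) else 0)"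
proof -
  have "(of_nat c :: int fps fps) = fps_const (fps_const (int c))"
    by (simp add: fps_of_nat)
  moreover have "fpsX ^ i = fps_X ^ i" "fpsY ^ j = fps_const (fps_X ^ j)"
    by (simp_all add: fpsX_def fpsY_def fps_const_power)
  ultimately have eq: "(of_nat c * fpsX ^ i * fpsY ^ j) * f =
      fps_const (fps_const (int c)) * (fps_X ^ i * (fps_const (fps_X ^ j) * f))"
    by (simp only: mult.assoc)
  show ?thesis
    unfolding eq by (simp add: fps_X_power_mult_nth)
qed

text \<open>The shift by \<open>(2, 1)\<close> lowers both \<open>n = a - b\<close> and
  \<open>b\<close> by 1 and so keeps \<open>n - b\<close> and the ceiling. Hence for
  \<open>n \<ge> 2\<close> and \<open>b \<ge> 1\<close> both terms of the count are \<open>p\<close>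
  times the shifted ones. The column \<open>b = 0\<close> and the diagonals \<open>n = 0\<close> and
  \<open>n = 1\<close> survive.\<close>

lemma mult_first_factor_nth:
  assumes "\<And>a b. F $ a $ b = int (subring_count p a b)"
  shows "((1 - of_nat p * fpsX ^ 2 * fpsY) * F) $ a $ b =
    (if b = 0 then int p ^ (2 * a div 3) else if a = b \<or> a = b + 1 then 1 else 0)"
proof -
  have "((1 - of_nat p * fpsX ^ 2 * fpsY) * F) $ a $ b =
    F $ a $ b - (if 2 \<le> a \<and> 1 \<le> b then int p * F $ (a - 2) $ (b - 1) else 0)"
    using fps_XY_mult_nth[of p 2 1 F a b] by (simp add: left_diff_distrib)
  also have "\<dots> = (if b = 0 then int p ^ (2 * a div 3) else if a = b \<or> a = b + 1 then 1 else 0)"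
  proof (cases "b = 0")
    case True
    have "a - (a + 2) div 3 = 2 * a div 3" by presburger
    then show ?thesis using True by (simp add: assms subring_count_def)
  next
    case False
    consider "a < b" | "a = b" | "a = b + 1" | "a \<ge> b + 2" by linarith
    then show ?thesis
    proof cases
      case 4
      then obtain n where a: "a = b + n + 2" by (metis add.assoc add.commute le_Suc_ex)
      obtain c where b: "b = c + 1" using False by (metis Suc_eq_plus1 not0_implies_Suc)
      \<comment> \<open>The ceiling is at most \<open>n + 1\<close>, so truncated subtraction
        commutes with the successor.\<close>
      have "(m + 2) div 3 \<le> m" for m :: nat by presburger
      then have "(n + 1 - c + 2) div 3 \<le> n + 1" by (meson diff_le_self order_trans)
      then have "n + 2 - (n + 2 - (c + 1) + 2) div 3 = Suc (n + 1 - (n + 1 - c + 2) div 3)"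
        by (simp add: Suc_diff_le)
      then show ?thesis by (simp add: assms subring_count_def a b algebra_simps)
    qed (use False in \<open>auto simp: assms subring_count_def\<close>)
  qed
  finally show ?thesis .
qed

text \<open>For \<open>b \<ge> 2\<close> the diagonals of ones cancel under the shift by
  \<open>(1, 1)\<close>. At \<open>b = 1\<close> the shifted column \<open>b = 0\<close> is
  subtracted; it starts with two ones, which cancel the entries at \<open>a = 1\<close> and
  \<open>a = 2\<close>.\<close>

lemma mult_second_factor_nth:
  assumes "\<And>a b. F $ a $ b = (if b = 0 then int p ^ (2 * a div 3) else if a = b \<or> a = b + 1 then 1 else 0)"
  shows "((1 - fpsX * fpsY) * F) $ a $ b =
    (if b = 0 then int p ^ (2 * a div 3)
     else if b = 1 \<and> a \<ge> 3 then - (int p ^ (2 * (a - 1) div 3)) else 0)"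
proof -
  have "((1 - fpsX * fpsY) * F) $ a $ b =
    F $ a $ b - (if 1 \<le> a \<and> 1 \<le> b then F $ (a - 1) $ (b - 1) else 0)"
    using fps_XY_mult_nth[of 1 1 1 F a b] by (simp add: left_diff_distrib)
  also have "\<dots> = (if b = 0 then int p ^ (2 * a div 3)
     else if b = 1 \<and> a \<ge> 3 then - (int p ^ (2 * (a - 1) div 3)) else 0)"
  proof (cases "b = 1 \<and> a < 3")
    case True
    then have "a = 0 \<or> a = 1 \<or> a = 2" by auto
    then show ?thesis using True by (auto simp: assms)
  qed (auto simp: assms)
  finally show ?thesis .
qed

text \<open>Raising \<open>a\<close> by 3 raises the floor of \<open>2 * a / 3\<close> by 2, so in
  steps of 3 each column is geometric with ratio \<open>p ^ 2\<close>. Only its first three entries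
  survive: \<open>a = 0, 1, 2\<close> for \<open>b = 0\<close> and \<open>a = 3, 4, 5\<close> for
  \<open>b = 1\<close>.\<close>

lemma mult_third_factor:
  assumes "\<And>a b. F $ a $ b = (if b = 0 then int p ^ (2 * a div 3)
     else if b = 1 \<and> a \<ge> 3 then - (int p ^ (2 * (a - 1) div 3)) else 0)"
  shows "(1 - of_nat p ^ 2 * fpsX ^ 3) * F =
      1 + fpsX + of_nat p * fpsX ^ 2 - of_nat p * fpsX ^ 3 * fpsY
           - of_nat p ^ 2 * fpsX ^ 4 * fpsY - of_nat p ^ 2 * fpsX ^ 5 * fpsY" (is "_ = ?R")
proof (intro fps_ext)
  fix a b
  have "((1 - of_nat p ^ 2 * fpsX ^ 3) * F) $ a $ b =
    F $ a $ b - (if 3 \<le> a then int p ^ 2 * F $ (a - 3) $ b else 0)"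
    using fps_XY_mult_nth[of "p^2" 3 0 F a b] by (simp add: left_diff_distrib)
  also have "\<dots> = (if b = 0 then (if a = 0 \<or> a = 1 then 1 else if a = 2 then int p else 0)
     else if b = 1 then (if a = 3 then - int p else if a = 4 \<or> a = 5 then - (int p ^ 2) else 0) else 0)"
  proof -
    consider "a = 0" | "a = 1" | "a = 2" | "a = 3" | "a = 4" | "a = 5" | "a \<ge> 6" by linarith
    then show ?thesis
    proof cases
      case 7
      then obtain k where a: "a = k + 6" by (metis add.commute le_Suc_ex)
      have "2 * (k + 6) div 3 = 2 + 2 * (k + 3) div 3" "2 * (k + 5) div 3 = 2 + 2 * (k + 2) div 3"
        by presburger+
      then have "int p ^ (2 * (k + 6) div 3) = int p ^ 2 * int p ^ (2 * (k + 3) div 3)"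
        "int p ^ (2 * (k + 5) div 3) = int p ^ 2 * int p ^ (2 * (k + 2) div 3)"
        by (simp_all only: power_add)
      then show ?thesis by (simp add: assms a algebra_simps)
    qed (auto simp: assms power2_eq_square power3_eq_cube)
  qed
  also have "\<dots> = ?R $ a $ b"
  proof -
    \<comment> \<open>The shift rule with \<open>f = 1\<close> gives the coefficients of a single
      monomial.\<close>
    have mono: "(of_nat c * fpsX ^ i * fpsY ^ j) $ a $ b = (if a = i \<and> b = j then int c else 0)" for c i j
      using fps_XY_mult_nth[of c i j 1 a b] by (auto split: if_splits)
    show ?thesis
      using mono[of 1 0 0] mono[of 1 1 0] mono[of p 2 0] mono[of p 3 1] mono[of "p^2" 4 1] mono[of "p^2" 5 1]
      by simp
  qed
  finally show "((1 - of_nat p ^ 2 * fpsX ^ 3) * F) $ a $ b = ?R $ a $ b" .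
qed

theorem theorem2:
  fixes p :: nat
  assumes "prime p"
  shows "zeta_R_p p * ((1 - fpsX * fpsY) * (1 - of_nat p * fpsX ^ 2 * fpsY) * (1 - of_nat p ^ 2 * fpsX ^ 3))
       = 1 + fpsX + of_nat p * fpsX ^ 2 - of_nat p * fpsX ^ 3 * fpsY
           - of_nat p ^ 2 * fpsX ^ 4 * fpsY - of_nat p ^ 2 * fpsX ^ 5 * fpsY"
proof -
  have "zeta_R_p p $ a $ b = int (subring_count p a b)" for a b
    by (simp add: zeta_R_p_def card_subrings[OF assms])
  \<comment> \<open>The factor with \<open>fpsX ^ 2 * fpsY\<close> acts first, then the one with
    \<open>fpsX * fpsY\<close>, then the one with \<open>fpsX ^ 3\<close>; commutativity restores
    the stated order.\<close>
  from mult_third_factor[OF mult_second_factor_nth[OF mult_first_factor_nth[OF this]]] show ?thesis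
    by (simp only: mult_ac)
qed

end
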